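(* Consider the building structure equipped with an active tuned mass damper (ATMD), described by $$\dot{\mathbf z}=\mathbf A\mathbf z+\mathbf B\,(u-f(z_3))+\mathbf D\,\ddot x_g,\qquad \mathbf z=[z_1,z_2,z_3,z_4]^{\mathrm T},$$ $$\mathbf A=\begin{bmatrix}0&0&1&0\\0&0&0&1\\-\frac{k_d(m_0+m_d)}{m_0m_d}&\frac{k_0}{m_0}&-\frac{c_d(m_0+m_d)}{m_0m_d}&\frac{c_0}{m_0}\\ \frac{k_d}{m_0}&-\frac{k_0}{m_0}&\frac{c_d}{m_0}&-\frac{c_0}{m_0}\end{bmatrix},\quad \mathbf B=\begin{bmatrix}0\\0\\\frac{m_0+m_d}{m_0m_d}\\-\frac1{m_0}\end{bmatrix},\quad \mathbf D=\begin{bmatrix}0\\0\\\beta_0-1\\-\beta_0\end{bmatrix}.$$ Assume that known constants $\delta,\varpi$ satisfy $|\ddot x_g|\le\delta$ and $|f(z_3)|\le\varpi$. Let $\lambda_1,\lambda_2,\lambda_3$ be the desired closed-loop eigenvalues, let $\lambda_4$ be real and negative, and put $$P_1(\lambda)=(\lambda-\lambda_1)(\lambda-\lambda_2)(\lambda-\lambda_3),\qquad P(\lambda)=P_1(\lambda)(\lambda-\lambda_4),$$ $$\mathbf e^{\mathrm T}=[0,0,0,1]\,[\mathbf B,\mathbf A\mathbf B,\mathbf A^2\mathbf B,\mathbf A^3\mathbf B]^{-1},\qquad \mathbf k^{\mathrm T}=\mathbf e^{\mathrm T}P(\mathbf A),\qquad u_a=-\mathbf k^{\mathrm T}\mathbf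 z.$$ Let the control force $u$ be provided by the sliding mode controller $$u=-M_0\,\mathrm{sign}(\sigma),\qquad \sigma=\boldsymbol\eta^{\mathrm T}\mathbf z,\qquad \boldsymbol\eta^{\mathrm T}=[\eta_1,\eta_2,\eta_3,\eta_4]=\mathbf e^{\mathrm T}P_1(\mathbf A)\in\mathbb R^{1\times4},$$ where the switching gain $M_0>0$ satisfies $M_0>\varpi+h_0$, and $h_0$ is a constant such that $$|u_a+\alpha_1\ddot x_g|\le h_0,\qquad \alpha_1=\beta_0(\eta_4-\eta_3)+\eta_3.$$ Then the trajectories of the closed-loop system reach the plane $\sigma=\boldsymbol\eta^{\mathrm T}\mathbf z=0$ in a finite time $t_\sigma$, and they are confined in this plane for $t\ge t_\sigma$, where $$t_\sigma\le\frac{|\sigma(0)|}{M_0-(\varpi+h_0)}.$$ Furthermore, when this plane is reached, the fourth-order system is reduced to the third-order system $$\dot{\mathbf z}^*=\mathbf A_1\mathbf z^*+\mathbf B_1\ddot x_g,\qquad \mathbf z^*=[z_1,z_2,z_3]^{\mathrm T},$$ where $\mathbf A_1\in\mathbb R^{3\times3}$ is a (constant) matrix whose eigenvalues are $\lambda_1,\lambda_2,\lambda_3$, and $$\mathbf B_1=\begin{bmatrix}0\\0\\\alpha_2\end{bmatrix},\qquad \alpha_2=(\beta_0-1)+\frac{\alpha_1(m_0+m_d)}{m_0m_d}.$$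
   Context: The system models the dominant vibration mode of a building (mass $m_0$, damping $c_0$, stiffness $k_0$, participation factor $\beta_0$) carrying an active tuned mass damper on its top floor (mass $m_d$, damping $c_d$, stiffness $k_d$, nonlinear friction $f(z_3)$). Here $z_1,z_3$ are the displacement (relative to the top floor) and velocity of the damper, $z_2,z_4$ are the displacement (relative to the ground) and velocity of the top floor, $u$ is the control force applied to the damper, and $\ddot x_g$ is the earthquake (ground) acceleration, an external time signal. For a polynomial $p$, $p(\mathbf A)$ denotes its evaluation at the matrix $\mathbf A$. The vector $\mathbf k$ is the feedback gain given by Ackermann's formula, which places the eigenvalues of $\mathbf A-\mathbf B\mathbf k^{\mathrm T}$ at $\lambda_1,\dots,\lambda_4$. The reduced third-order system describes the closed loop in the sliding mode on the plane $\sigma=0$.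
   Formalization: The reduction to the third-order system is stated only for η_4 ≠ 0; if η_4 = 0, z_4 is free in the plane σ=0 and the claim fails (e.g. m_0=m_d=k_0=1, c_0=2, λ_1=λ_2=λ_3=-1/2). Trajectories are Filippov solutions, and m_0, m_d, k_0 > 0. *)

theory Defs
  imports "HOL-Analysis.Analysis" "HOL-Computational_Algebra.Polynomial"
begin

definition matrix_power :: "'a::semiring_1^'n^'n \<Rightarrow> nat \<Rightarrow> 'a^'n^'n" where
  "matrix_power M n = (((**) M) ^^ n) (mat 1)"

definition poly_matrix :: "real poly \<Rightarrow> real^'n^'n \<Rightarrow> real^'n^'n" where
  "poly_matrix p M = (\<Sum>i\<le>degree p. coeff p i *\<^sub>R matrix_power M i)"

definition is_eigenvalue :: "complex^'n^'n \<Rightarrow> complex \<Rightarrow> bool" where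
  "is_eigenvalue M s \<longleftrightarrow> (\<exists>v. v \<noteq> 0 \<and> M *v v = s *s v)"

text \<open>State \<open>z = (z\<^sub>1, z\<^sub>2, z\<^sub>3, z\<^sub>4)\<close>: damper displacement relative to the top floor,
  top floor displacement relative to the ground, and the corresponding velocities.\<close>

definition atmd_A :: "real \<Rightarrow> real \<Rightarrow> real \<Rightarrow> real \<Rightarrow> real \<Rightarrow> real \<Rightarrow> real^4^4" where
  "atmd_A m\<^sub>0 c\<^sub>0 k\<^sub>0 m\<^sub>d c\<^sub>d k\<^sub>d = vector
    [vector [0, 0, 1, 0],
     vector [0, 0, 0, 1],
     vector [- (k\<^sub>d * (m\<^sub>0 + m\<^sub>d) / (m\<^sub>0 * m\<^sub>d)), k\<^sub>0 / m\<^sub>0,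
             - (c\<^sub>d * (m\<^sub>0 + m\<^sub>d) / (m\<^sub>0 * m\<^sub>d)), c\<^sub>0 / m\<^sub>0],
     vector [k\<^sub>d / m\<^sub>0, - (k\<^sub>0 / m\<^sub>0), c\<^sub>d / m\<^sub>0, - (c\<^sub>0 / m\<^sub>0)]]"

definition atmd_B :: "real \<Rightarrow> real \<Rightarrow> real^4" where
  "atmd_B m\<^sub>0 m\<^sub>d = vector [0, 0, (m\<^sub>0 + m\<^sub>d) / (m\<^sub>0 * m\<^sub>d), - (1 / m\<^sub>0)]"

definition atmd_D :: "real \<Rightarrow> real^4" where
  "atmd_D \<beta>\<^sub>0 = vector [0, 0, \<beta>\<^sub>0 - 1, - \<beta>\<^sub>0]"

text \<open>The \<^const>\<open>transpose\<close> makes the listed vectors the columns.\<close>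

definition controllability_matrix :: "real^4^4 \<Rightarrow> real^4 \<Rightarrow> real^4^4" where
  "controllability_matrix A B = transpose (vector
    [B, A *v B, matrix_power A 2 *v B, matrix_power A 3 *v B])"

definition ackermann_vector :: "real^4^4 \<Rightarrow> real^4 \<Rightarrow> real^4" where
  "ackermann_vector A B = vector [0, 0, 0, 1] v* matrix_inv (controllability_matrix A B)"

text \<open>The intervals of the division \<open>d\<close> are nonempty and compact with disjoint interiors,
  so \<open>Sup K - Inf K\<close> is the length of \<open>K\<close>; \<open>d\<close> need not cover \<open>S\<close>.\<close>

definition absolutely_continuous_on :: "real set \<Rightarrow> (real \<Rightarrow> 'a::real_normed_vector) \<Rightarrow> bool" where
  "absolutely_continuous_on S x \<longleftrightarrow>
    (\<forall>\<epsilon>>0. \<exists>\<delta>>0. \<forall>d T. d division_of T \<and> T \<subseteq> S \<and> (\<Sum>K\<in>d. Sup K - Inf K) < \<delta> \<longrightarrow>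
      (\<Sum>K\<in>d. norm (x (Sup K) - x (Inf K))) < \<epsilon>)"

text \<open>Caratheodory solutions on \<open>[t\<^sub>0, \<infinity>)\<close> of the differential inclusion \<open>x' \<in> F t x\<close>; a
  differential equation is the case of a singleton-valued \<open>F\<close>.\<close>

definition inclusion_solution ::
    "(real \<Rightarrow> 'a::euclidean_space \<Rightarrow> 'a set) \<Rightarrow> real \<Rightarrow> (real \<Rightarrow> 'a) \<Rightarrow> bool" where
  "inclusion_solution F t\<^sub>0 x \<longleftrightarrow>
    (\<forall>T. absolutely_continuous_on {t\<^sub>0..T} x) \<and>
    (AE t in lebesgue. t\<^sub>0 < t \<longrightarrow> (\<exists>v\<in>F t (x t). (x has_vector_derivative v) (at t)))"

text \<open>Filippov's convex regularisation of a discontinuous vector field. With the classical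
  notion of solution a relay-controlled system has in general no trajectories inside its
  switching plane, so its sliding motion has to be understood through this regularisation.\<close>

definition filippov :: "('a::euclidean_space \<Rightarrow> 'a) \<Rightarrow> 'a \<Rightarrow> 'a set" where
  "filippov g x =
    (\<Inter>r\<in>{0<..}. \<Inter>N\<in>{N. negligible N}. closure (convex hull (g ` (ball x r - N))))"

end

theory Submission
  imports Defs
begin

text \<open>Ackermann's formula makes \<open>\<eta> \<bullet> B = 1\<close> and \<open>\<eta>\<^sup>T A = k\<^sup>T + \<mu>\<^sub>4 \<eta>\<^sup>T\<close>, so along a Filippov solution
  \<open>\<sigma> = \<eta> \<bullet> z\<close> satisfies \<open>\<sigma>' = \<mu>\<^sub>4 \<sigma> - (u\<^sub>a + \<alpha>\<^sub>1 x\<^sub>g) + u - f\<close>. Off the plane the relay dominates, and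
  \<open>\<bar>\<sigma>\<bar>\<close> decreases at rate at least \<open>M\<^sub>0 - (\<omega> + h\<^sub>0)\<close> until it vanishes. On the plane the equation
  \<open>\<eta> \<bullet> z' = 0\<close> determines the component of \<open>z'\<close> along \<open>B\<close>, the only one affected by the
  regularisation; eliminating \<open>z\<^sub>4\<close> gives the third-order system.\<close>

section \<open>Absolutely continuous functions\<close>

lemma absolutely_continuous_on_subset:
  "absolutely_continuous_on S x \<Longrightarrow> T \<subseteq> S \<Longrightarrow> absolutely_continuous_on T x"
  unfolding absolutely_continuous_on_def by (meson order_trans)

lemma absolutely_continuous_onE:
  assumes "absolutely_continuous_on S x" "\<epsilon> > 0"
  obtains \<delta> where "\<delta> > 0" "\<And>d T. d division_of T \<Longrightarrow> T \<subseteq> S \<Longrightarrow>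
    (\<Sum>K\<in>d. Sup K - Inf K) < \<delta> \<Longrightarrow> (\<Sum>K\<in>d. norm (x (Sup K) - x (Inf K))) < \<epsilon>"
proof -
  from assms(1)[unfolded absolutely_continuous_on_def, rule_format, OF assms(2)]
  obtain \<delta> where "\<delta> > 0" and \<delta>: "\<forall>d T. d division_of T \<and> T \<subseteq> S \<and> (\<Sum>K\<in>d. Sup K - Inf K) < \<delta> \<longrightarrow>
      (\<Sum>K\<in>d. norm (x (Sup K) - x (Inf K))) < \<epsilon>"
    by (elim exE conjE)
  show thesis
    by (rule that[OF \<open>\<delta> > 0\<close>]) (rule \<delta>[rule_format], intro conjI)
qed

text \<open>A Lipschitz map multiplies every variation sum by at most a constant. Besides bounded
  linear maps this covers the absolute value, which is needed to pass from \<sigma> to its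
  modulus.\<close>

lemma absolutely_continuous_on_lipschitz_image:
  assumes ac: "absolutely_continuous_on S x"
    and lip: "\<And>u v. norm (g u - g v) \<le> L * norm (u - v)"
  shows "absolutely_continuous_on S (\<lambda>t. g (x t))"
  unfolding absolutely_continuous_on_def
proof (intro allI impI)
  fix \<epsilon> :: real assume "\<epsilon> > 0"
  \<comment> \<open>Adding 1 keeps the constant strictly positive for every \<open>L\<close>, so
    that dividing \<epsilon> by it is legitimate.\<close>
  define B where "B = \<bar>L\<bar> + 1"
  have "B > 0" by (simp add: B_def add_nonneg_pos)
  with \<open>\<epsilon> > 0\<close> have "\<epsilon> / B > 0" by simp
  then obtain \<delta> where "\<delta> > 0" and \<delta>: "\<And>d T. d division_of T \<Longrightarrow> T \<subseteq> S \<Longrightarrow>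
      (\<Sum>K\<in>d. Sup K - Inf K) < \<delta> \<Longrightarrow> (\<Sum>K\<in>d. norm (x (Sup K) - x (Inf K))) < \<epsilon> / B"
    using absolutely_continuous_onE[OF ac] by blast
  show "\<exists>\<delta>>0. \<forall>d T. d division_of T \<and> T \<subseteq> S \<and> (\<Sum>K\<in>d. Sup K - Inf K) < \<delta> \<longrightarrow>
      (\<Sum>K\<in>d. norm (g (x (Sup K)) - g (x (Inf K)))) < \<epsilon>"
  proof (intro exI[of _ \<delta>] conjI allI impI \<open>\<delta> > 0\<close>)
    fix d T assume d: "d division_of T \<and> T \<subseteq> S \<and> (\<Sum>K\<in>d. Sup K - Inf K) < \<delta>"
    have "norm (g u - g v) \<le> B * norm (u - v)" for u v
      by (rule order_trans[OF lip mult_right_mono]) (simp_all add: B_def)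
    then have "(\<Sum>K\<in>d. norm (g (x (Sup K)) - g (x (Inf K))))
        \<le> B * (\<Sum>K\<in>d. norm (x (Sup K) - x (Inf K)))"
      unfolding sum_distrib_left by (intro sum_mono)
    also have "\<dots> < B * (\<epsilon> / B)"
      using \<delta>[of d T] d \<open>B > 0\<close> by (intro mult_strict_left_mono) auto
    finally show "(\<Sum>K\<in>d. norm (g (x (Sup K)) - g (x (Inf K)))) < \<epsilon>"
      using \<open>B > 0\<close> by simp
  qed
qed

lemma absolutely_continuous_on_bounded_linear:
  assumes "absolutely_continuous_on S x" "bounded_linear g"
  shows "absolutely_continuous_on S (\<lambda>t. g (x t))"
proof -
  obtain L where "\<And>u. norm (g u) \<le> norm u * L"
    using bounded_linear.bounded[OF assms(2)] by blast
  then have "norm (g u - g v) \<le> L * norm (u - v)" for u v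
    by (metis assms(2) linear_simps(2) mult.commute)
  then show ?thesis
    by (rule absolutely_continuous_on_lipschitz_image[OF assms(1)])
qed

lemma absolutely_continuous_on_imp_continuous_on:
  assumes "absolutely_continuous_on {a..b} x"
  shows "continuous_on {a..b} x"
  unfolding continuous_on_iff
proof (intro ballI allI impI)
  fix s and \<epsilon> :: real assume s: "s \<in> {a..b}" and "\<epsilon> > 0"
  from \<open>\<epsilon> > 0\<close> obtain \<delta> where "\<delta> > 0" and \<delta>: "\<And>d T. d division_of T \<Longrightarrow> T \<subseteq> {a..b} \<Longrightarrow>
      (\<Sum>K\<in>d. Sup K - Inf K) < \<delta> \<Longrightarrow> (\<Sum>K\<in>d. norm (x (Sup K) - x (Inf K))) < \<epsilon>"
    using absolutely_continuous_onE[OF assms] by blast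
  \<comment> \<open>A division consisting of one interval turns the variation bound into a modulus
    of continuity.\<close>
  have close: "norm (x v - x u) < \<epsilon>" if "u \<in> {a..b}" "v \<in> {a..b}" "u \<le> v" "v - u < \<delta>" for u v
    using \<delta>[of "{{u..v}}" "{u..v}"] division_of_self[of u v] that by auto
  show "\<exists>\<delta>>0. \<forall>t\<in>{a..b}. dist t s < \<delta> \<longrightarrow> dist (x t) (x s) < \<epsilon>"
  proof (intro exI[of _ \<delta>] conjI ballI impI \<open>\<delta> > 0\<close>)
    fix t assume "t \<in> {a..b}" "dist t s < \<delta>"
    then show "dist (x t) (x s) < \<epsilon>"
      using close[of s t] close[of t s] s
      by (cases "s \<le> t") (auto simp: dist_norm norm_minus_commute)
  qed
qed

text \<open>The straddle estimate: subtract the first-order expansions of \<open>w\<close> at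
  \<open>s\<close> in \<open>u\<close> and in \<open>v\<close>. Since \<open>s\<close> lies between
  them, the two errors add up to at most \<epsilon> times \<open>v - u\<close>.\<close>

lemma has_real_derivative_ball_increment:
  fixes w :: "real \<Rightarrow> real"
  assumes "(w has_real_derivative d) (at s)" "\<epsilon> > 0"
  shows "\<exists>r>0. \<forall>u v. u \<le> s \<and> s \<le> v \<and> {u..v} \<subseteq> ball s r \<longrightarrow> w v - w u \<le> (d + \<epsilon>) * (v - u)"
proof -
  have "(w has_derivative (\<lambda>h. d * h)) (at s)"
    using assms(1) by (simp add: has_field_derivative_def)
  then obtain r where "r > 0" and r: "\<And>y. norm (y - s) < r \<Longrightarrow>
      norm (w y - w s - d * (y - s)) \<le> \<epsilon> * norm (y - s)"
    using assms(2) unfolding has_derivative_at_alt by metis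
  show ?thesis
  proof (intro exI[of _ r] conjI allI impI \<open>r > 0\<close>)
    fix u v assume uv: "u \<le> s \<and> s \<le> v \<and> {u..v} \<subseteq> ball s r"
    then have "u \<in> ball s r" "v \<in> ball s r" by (simp_all add: subset_iff del: mem_ball)
    then have "\<bar>u - s\<bar> < r" "\<bar>v - s\<bar> < r"
      by (simp_all add: dist_real_def)
    with r[of u] r[of v] uv have "w s - w u + d * (u - s) \<le> \<epsilon> * (s - u)" "w v - w s - d * (v - s) \<le> \<epsilon> * (v - s)"
      by auto
    then show "w v - w u \<le> (d + \<epsilon>) * (v - u)"
      by (simp add: algebra_simps)
  qed
qed

text \<open>Cousin's lemma: on a fine tagged division, the intervals with an exceptional tag have small
  total length (the indicator of a negligible set has gauge integral 0), so by absolute continuity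
  they contribute little; the other intervals are controlled by the derivative at the tag.\<close>

lemma absolutely_continuous_on_decrease:
  fixes w :: "real \<Rightarrow> real"
  assumes ac: "absolutely_continuous_on {a..b} w" and "a \<le> b" and N: "negligible N"
    and deriv: "\<And>s. s \<in> {a<..<b} - N \<Longrightarrow> \<exists>d\<le>-c. (w has_real_derivative d) (at s)"
  shows "w b - w a \<le> - c * (b - a)"
proof -
  \<comment> \<open>The endpoints count as exceptional because a derivative is only available in the
    open interval.\<close>
  define N' where "N' = N \<union> {a, b}"
  have "negligible N'" using N by (simp add: N'_def)
  \<comment> \<open>The three error terms come from the variation over the bad intervals, the slack
    of the derivative estimate over the length \<open>b - a\<close>, and the length of the bad
    intervals weighted by \<open>c\<close>.\<close>
  have bound: "w b - w a \<le> - c * (b - a) + \<epsilon> * (1 + (b - a) + \<bar>c\<bar>)" if "\<epsilon> > 0" for \<epsilon>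
  proof -
    from \<open>\<epsilon> > 0\<close> obtain \<delta> where "\<delta> > 0" and \<delta>: "\<And>d T. d division_of T \<Longrightarrow> T \<subseteq> {a..b} \<Longrightarrow>
        (\<Sum>K\<in>d. Sup K - Inf K) < \<delta> \<Longrightarrow> (\<Sum>K\<in>d. norm (w (Sup K) - w (Inf K))) < \<epsilon>"
      using absolutely_continuous_onE[OF ac] by blast
    have "(indicator N' has_integral (0::real)) (cbox a b)"
      using \<open>negligible N'\<close> by (simp add: negligible_def)
    \<comment> \<open>Length below \<delta> makes absolute continuity applicable to the bad
      intervals; length below \<epsilon> controls the term \<open>c * L\<close> at the end.\<close>
    moreover have "min \<delta> \<epsilon> > 0" using \<open>\<delta> > 0\<close> \<open>\<epsilon> > 0\<close> by simp
    ultimately obtain \<gamma> where "gauge \<gamma>" and \<gamma>: "\<And>p. p tagged_division_of (cbox a b) \<Longrightarrow> \<gamma> fine p \<Longrightarrow>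
        norm ((\<Sum>(x,K)\<in>p. measure lborel K *\<^sub>R indicator N' x) - (0::real)) < min \<delta> \<epsilon>"
      unfolding has_integral by meson
    \<comment> \<open>A gauge needs a radius at every point; at exceptional points the condition is
      vacuous and radius 1 will do.\<close>
    have "\<exists>r>0. s \<in> {a<..<b} - N \<longrightarrow>
        (\<forall>u v. u \<le> s \<and> s \<le> v \<and> {u..v} \<subseteq> ball s r \<longrightarrow> w v - w u \<le> (\<epsilon> - c) * (v - u))" for s
    proof (cases "s \<in> {a<..<b} - N")
      case True
      with deriv obtain d where d: "d \<le> -c" "(w has_real_derivative d) (at s)" by blast
      obtain r where r: "r > 0" "\<And>u v. u \<le> s \<Longrightarrow> s \<le> v \<Longrightarrow> {u..v} \<subseteq> ball s r \<Longrightarrow>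
          w v - w u \<le> (d + \<epsilon>) * (v - u)"
        using has_real_derivative_ball_increment[OF d(2) \<open>\<epsilon> > 0\<close>] by blast
      have "(d + \<epsilon>) * (v - u) \<le> (\<epsilon> - c) * (v - u)" if "u \<le> s" "s \<le> v" for u v
        using d that by (intro mult_right_mono) auto
      with r show ?thesis by (meson order_trans)
    qed (auto intro: exI[of _ 1])
    then obtain r where r: "\<And>s. r s > 0" "\<And>s u v. s \<in> {a<..<b} - N \<Longrightarrow> u \<le> s \<Longrightarrow> s \<le> v \<Longrightarrow>
        {u..v} \<subseteq> ball s (r s) \<Longrightarrow> w v - w u \<le> (\<epsilon> - c) * (v - u)"
      by metis
    have "gauge (\<lambda>s. \<gamma> s \<inter> ball s (r s))"
      by (intro gauge_Int \<open>gauge \<gamma>\<close> gauge_ball_dependent) (use r in auto)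
    then obtain p where p: "p tagged_division_of {a..b}" and fine: "(\<lambda>s. \<gamma> s \<inter> ball s (r s)) fine p"
      by (rule fine_division_exists_real)
    then have fine: "\<gamma> fine p" "(\<lambda>s. ball s (r s)) fine p" by (auto simp: fine_Int)
    define bad where "bad = {q \<in> p. fst q \<in> N'}"
    have "finite p" using p by blast
    have "bad \<subseteq> p" by (auto simp: bad_def)
    have tag: "\<exists>u v. K = {u..v} \<and> u \<le> s \<and> s \<le> v \<and> a \<le> u \<and> v \<le> b" if sK: "(s, K) \<in> p" for s K
    proof -
      obtain u v where K: "K = cbox u v" using tagged_division_ofD(4)[OF p sK] by blast
      moreover have "s \<in> K" "K \<subseteq> {a..b}" using tagged_division_ofD(2,3)[OF p sK] by auto
      ultimately show ?thesis by (intro exI[of _ u] exI[of _ v]) auto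
    qed
    have len: "measure lborel K = Sup K - Inf K" if "(s, K) \<in> p" for s K
      using tag[OF that] by auto
    have bad_len: "(\<Sum>(s,K)\<in>bad. Sup K - Inf K) < min \<delta> \<epsilon>"
    proof -
      have "(\<Sum>(s,K)\<in>bad. Sup K - Inf K) = (\<Sum>(s,K)\<in>p. measure lborel K *\<^sub>R indicator N' s)"
        using \<open>finite p\<close> len by (intro sum.mono_neutral_cong_left) (auto simp: bad_def indicator_def split: if_splits)
      also have "\<dots> < min \<delta> \<epsilon>" using \<gamma>[of p] p fine by auto
      finally show ?thesis .
    qed
    have bad_div: "snd ` bad division_of \<Union>(snd ` bad)" and bad_tag: "bad tagged_division_of \<Union>(snd ` bad)"
      using p \<open>bad \<subseteq> p\<close> by (metis partial_division_of_tagged_division tagged_division_of_def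
          tagged_partial_division_subset, metis tagged_division_of_def tagged_partial_division_of_Union_self
          tagged_partial_division_subset)
    have null: "Sup (cbox u v) = Inf (cbox u v)" if "box u v = {}" "cbox u v \<noteq> {}" for u v :: real
      using that by auto
    \<comment> \<open>Absolute continuity sums over intervals, a tagged division over pairs. Pairs
      with different tags can share only an interval without interior, which contributes nothing
      when \<open>g u u = 0\<close>.\<close>
    have reindex: "(\<Sum>K\<in>snd ` bad. g (Inf K) (Sup K)) = (\<Sum>(s,K)\<in>bad. g (Inf K) (Sup K))"
      if "\<And>u. g u u = 0" for g :: "real \<Rightarrow> real \<Rightarrow> real"
    proof -
      \<comment> \<open>Reindexing requires the value 0 on all boxes with empty interior, including
        the empty box, where \<open>Inf\<close> and \<open>Sup\<close> carry no information.\<close>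
      define h where "h K = (if K = {} then 0 else g (Inf K) (Sup K))" for K
      have ne: "K \<noteq> {}" if "(s, K) \<in> bad" for s K
        using that \<open>bad \<subseteq> p\<close> tag by fastforce
      have "(\<Sum>K\<in>snd ` bad. g (Inf K) (Sup K)) = sum h (snd ` bad)"
        using ne by (intro sum.cong) (auto simp: h_def)
      also have "\<dots> = (\<Sum>(s,K)\<in>bad. h K)"
        by (rule sum.over_tagged_division_lemma[OF bad_tag, symmetric])
          (metis h_def null that)
      also have "\<dots> = (\<Sum>(s,K)\<in>bad. g (Inf K) (Sup K))"
        using ne by (intro sum.cong) (auto simp: h_def)
      finally show ?thesis .
    qed
    have "\<Union>(snd ` bad) \<subseteq> {a..b}" using p \<open>bad \<subseteq> p\<close> by (force dest: tagged_division_ofD(3))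
    then have "(\<Sum>K\<in>snd ` bad. norm (w (Sup K) - w (Inf K))) < \<epsilon>"
      using bad_len reindex[of "\<lambda>u v. v - u"] by (intro \<delta>[OF bad_div]) simp_all
    then have bad_var: "(\<Sum>(s,K)\<in>bad. w (Sup K) - w (Inf K)) < \<epsilon>"
      using reindex[of "\<lambda>u v. norm (w v - w u)"] sum_mono[of bad "\<lambda>(s,K). w (Sup K) - w (Inf K)" "\<lambda>(s,K). norm (w (Sup K) - w (Inf K))"]
      by force
    have good_var: "(\<Sum>(s,K)\<in>p-bad. w (Sup K) - w (Inf K)) \<le> (\<Sum>(s,K)\<in>p-bad. (\<epsilon> - c) * (Sup K - Inf K))"
    proof (intro sum_mono, clarify)
      fix s K assume sK: "(s, K) \<in> p" "(s, K) \<notin> bad"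
      obtain u v where K: "K = {u..v}" "u \<le> s" "s \<le> v" "a \<le> u" "v \<le> b" using tag[OF sK(1)] by blast
      have "s \<in> {a<..<b} - N" using sK K by (force simp: bad_def N'_def)
      moreover have "{u..v} \<subseteq> ball s (r s)" using fineD[OF fine(2) sK(1)] K by simp
      ultimately show "w (Sup K) - w (Inf K) \<le> (\<epsilon> - c) * (Sup K - Inf K)"
        using r(2) K by simp
    qed
    have split: "(\<Sum>q\<in>p. g q) = (\<Sum>q\<in>bad. g q) + (\<Sum>q\<in>p-bad. g q)" for g :: "real \<times> real set \<Rightarrow> real"
      using sum.subset_diff[OF \<open>bad \<subseteq> p\<close> \<open>finite p\<close>, of g] by simp
    define L where "L = (\<Sum>(s,K)\<in>bad. Sup K - Inf K)"
    have "L \<ge> 0" unfolding L_def using \<open>bad \<subseteq> p\<close> tag by (intro sum_nonneg) fastforce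
    have total: "(\<Sum>(s,K)\<in>p. Sup K - Inf K) = b - a"
      using additive_tagged_division_1[OF \<open>a \<le> b\<close> p, of "\<lambda>t. t"] by simp
    have "w b - w a = (\<Sum>(s,K)\<in>p. w (Sup K) - w (Inf K))"
      using additive_tagged_division_1[OF \<open>a \<le> b\<close> p, of w] by simp
    also have "\<dots> \<le> \<epsilon> + (\<Sum>(s,K)\<in>p-bad. (\<epsilon> - c) * (Sup K - Inf K))"
      unfolding split using bad_var good_var by linarith
    also have "(\<Sum>(s,K)\<in>p-bad. (\<epsilon> - c) * (Sup K - Inf K)) = (\<epsilon> - c) * (b - a - L)"
      using total split[of "\<lambda>(s,K). Sup K - Inf K"]
      by (simp add: L_def sum_distrib_left[symmetric] case_prod_unfold)
    also have "\<dots> \<le> - c * (b - a) + \<epsilon> * (b - a) + \<bar>c\<bar> * \<epsilon>"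
    proof -
      have "c * L \<le> \<bar>c\<bar> * \<epsilon>"
        using \<open>L \<ge> 0\<close> bad_len by (intro mult_mono) (auto simp: L_def)
      moreover have "0 \<le> \<epsilon> * L" using \<open>L \<ge> 0\<close> \<open>\<epsilon> > 0\<close> by simp
      ultimately show ?thesis by (simp add: algebra_simps)
    qed
    finally show ?thesis by (simp add: algebra_simps)
  qed
  show ?thesis
  proof (rule field_le_epsilon)
    fix e :: real assume "e > 0"
    have pos: "1 + (b - a) + \<bar>c\<bar> > 0" using \<open>a \<le> b\<close> by simp
    show "w b - w a \<le> - c * (b - a) + e"
      using bound[of "e / (1 + (b - a) + \<bar>c\<bar>)"] pos \<open>e > 0\<close> by simp
  qed
qed

section \<open>Vanishing in finite time\<close>

lemma AE_lebesgueE: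
  fixes P :: "real \<Rightarrow> bool"
  assumes "AE t in lebesgue. P t"
  obtains N where "negligible N" "\<And>t. t \<notin> N \<Longrightarrow> P t"
  using assms by (auto simp: eventually_ae_filter negligible_iff_null_sets)

text \<open>By continuity the sign of \<open>w\<close> is constant near \<open>t\<close>, so the
  modulus is locally a fixed multiple of \<open>w\<close>.\<close>

lemma has_real_derivative_abs:
  fixes w :: "real \<Rightarrow> real"
  assumes "(w has_real_derivative d) (at t)" "w t \<noteq> 0"
  shows "((\<lambda>t. \<bar>w t\<bar>) has_real_derivative sgn (w t) * d) (at t)"
proof -
  have lim: "(w \<longlongrightarrow> w t) (at t)"
    using DERIV_isCont[OF assms(1)] by (simp add: isCont_def)
  have "\<forall>\<^sub>F s in at t. sgn (w s) = sgn (w t)"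
  proof (cases "w t > 0")
    case True
    show ?thesis using order_tendstoD(1)[OF lim True] by eventually_elim (use True in auto)
  next
    case False
    then have "w t < 0" using assms(2) by simp
    show ?thesis using order_tendstoD(2)[OF lim \<open>w t < 0\<close>] by eventually_elim (use \<open>w t < 0\<close> in auto)
  qed
  then have ev: "\<forall>\<^sub>F s in at t. \<bar>w s\<bar> = sgn (w t) * w s"
    by eventually_elim (metis abs_sgn mult.commute)
  have "((\<lambda>s. sgn (w t) * w s) has_real_derivative sgn (w t) * d) (at t)"
    by (rule DERIV_cmult[OF assms(1)])
  then show ?thesis
    using has_field_derivative_cong_eventually[OF ev, of "sgn (w t) * d"] by (simp add: abs_sgn mult.commute)
qed

text \<open>Once it vanishes, \<open>w\<close> stays zero: otherwise it would decrease from its last zero on.\<close>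

lemma nonneg_decrease_reaches_zero:
  fixes w :: "real \<Rightarrow> real"
  assumes ac: "\<And>T. absolutely_continuous_on {0..T} w"
    and nonneg: "\<And>t. 0 \<le> w t" and "c > 0"
    and AE: "AE t in lebesgue. 0 < t \<longrightarrow> w t \<noteq> 0 \<longrightarrow> (\<exists>d\<le>-c. (w has_real_derivative d) (at t))"
  obtains t0 where "0 \<le> t0" "t0 \<le> w 0 / c" "\<And>t. 0 \<le> t \<Longrightarrow> t < t0 \<Longrightarrow> w t \<noteq> 0"
    "\<And>t. t0 \<le> t \<Longrightarrow> w t = 0"
proof -
  obtain N where N: "negligible N"
    "\<And>t. t \<notin> N \<Longrightarrow> 0 < t \<Longrightarrow> w t \<noteq> 0 \<Longrightarrow> \<exists>d\<le>-c. (w has_real_derivative d) (at t)"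
    using AE_lebesgueE[OF AE] by blast
  have decr: "w b - w a \<le> - c * (b - a)"
    if "0 \<le> a" "a \<le> b" "\<And>t. t \<in> {a<..<b} \<Longrightarrow> w t \<noteq> 0" for a b
    using that by (intro absolutely_continuous_on_decrease[OF absolutely_continuous_on_subset[OF ac[of b]] _ N(1)] N(2)) auto
  have cont: "continuous_on {0..T} w" for T
    by (rule absolutely_continuous_on_imp_continuous_on[OF ac])
  have closed: "closed {t \<in> {a..b}. w t = 0}" if "0 \<le> a" for a b
    using continuous_on_subset[OF cont[of b], of "{a..b}"] that
    by (intro continuous_closed_preimage_constant) auto
  \<comment> \<open>The time at which the line \<open>w 0 - c * t\<close> reaches zero. Without a
    zero up to \<open>T\<close> the decrease would force \<open>w T \<le> 0\<close>, hence a zero at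
    \<open>T\<close> itself.\<close>
  define T where "T = w 0 / c"
  have "T \<ge> 0" using nonneg \<open>c > 0\<close> by (simp add: T_def)
  define Z where "Z = {t \<in> {0..T}. w t = 0}"
  have "Z \<noteq> {}"
  proof
    assume "Z = {}"
    then have nz: "\<And>t. 0 \<le> t \<Longrightarrow> t \<le> T \<Longrightarrow> w t \<noteq> 0" by (auto simp: Z_def)
    then have "w T - w 0 \<le> - c * (T - 0)" using \<open>T \<ge> 0\<close> by (intro decr) auto
    then have "w T \<le> 0" using \<open>c > 0\<close> by (simp add: T_def)
    with nz[of T] nonneg[of T] \<open>T \<ge> 0\<close> show False by simp
  qed
  have "bdd_below Z" by (auto simp: Z_def intro: bdd_belowI[of _ 0])
  have "closed Z" using closed[of 0 T] by (simp add: Z_def)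
  have first: "Inf Z \<in> Z"
    by (rule closed_contains_Inf[OF \<open>Z \<noteq> {}\<close> \<open>bdd_below Z\<close> \<open>closed Z\<close>])
  show thesis
  proof
    show "0 \<le> Inf Z" "Inf Z \<le> w 0 / c" using first by (auto simp: Z_def T_def)
    show "w t \<noteq> 0" if "0 \<le> t" "t < Inf Z" for t
      using that cInf_lower[OF _ \<open>bdd_below Z\<close>, of t] first by (force simp: Z_def)
    show "w t = 0" if t: "Inf Z \<le> t" for t
    proof (rule ccontr)
      assume "w t \<noteq> 0"
      define Y where "Y = {s \<in> {Inf Z..t}. w s = 0}"
      have "Inf Z \<ge> 0" "w (Inf Z) = 0" using first by (auto simp: Z_def)
      then have Y: "closed Y" "Y \<noteq> {}" "bdd_above Y"
        using t closed[of "Inf Z" t] by (auto simp: Y_def intro: bdd_aboveI[of _ t])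
      have last: "Sup Y \<in> Y"
        by (rule closed_contains_Sup[OF Y(2,3,1)])
      have nz: "w s \<noteq> 0" if "s \<in> {Sup Y<..<t}" for s
        using that cSup_upper[OF _ Y(3), of s] last by (force simp: Y_def)
      have "0 \<le> Sup Y" "Sup Y \<le> t"
        using last \<open>Inf Z \<ge> 0\<close> by (auto simp: Y_def)
      then have "w t - w (Sup Y) \<le> - c * (t - Sup Y)"
        by (rule decr) (rule nz)
      also have "\<dots> \<le> 0"
        using last \<open>c > 0\<close> by (auto simp: Y_def mult_nonneg_nonneg)
      finally show False using last nonneg[of t] \<open>w t \<noteq> 0\<close> by (auto simp: Y_def)
    qed
  qed
qed

section \<open>Linear functionals on Filippov's regularisation\<close>

text \<open>A half-space is closed and convex, so if it contains the values of \<open>g\<close> near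
  \<open>x\<close>, it contains the closed convex hull of these values.\<close>

lemma filippov_inner_le:
  assumes v: "v \<in> filippov g x"
    and ev: "\<forall>\<^sub>F y in nhds x. l \<bullet> g y \<le> h y"
    and h: "(h \<longlongrightarrow> h x) (nhds x)"
  shows "l \<bullet> v \<le> h x"
proof (rule field_le_epsilon)
  fix \<epsilon> :: real assume "\<epsilon> > 0"
  have "\<forall>\<^sub>F y in nhds x. h y < h x + \<epsilon>"
    using order_tendstoD(2)[OF h] \<open>\<epsilon> > 0\<close> by simp
  with ev have "\<forall>\<^sub>F y in nhds x. l \<bullet> g y \<le> h x + \<epsilon>"
    by eventually_elim simp
  then obtain r where "r > 0" and r: "\<And>y. dist y x < r \<Longrightarrow> l \<bullet> g y \<le> h x + \<epsilon>"
    unfolding eventually_nhds_metric by blast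
  \<comment> \<open>The regularisation intersects over all negligible sets; the empty one is
    chosen.\<close>
  have "v \<in> closure (convex hull (g ` (ball x r - {})))"
    using v \<open>r > 0\<close> negligible_empty unfolding filippov_def by blast
  also have "\<dots> \<subseteq> {u. l \<bullet> u \<le> h x + \<epsilon>}"
    by (intro closure_minimal hull_minimal)
      (auto simp: r dist_commute convex_halfspace_le closed_halfspace_le)
  finally show "l \<bullet> v \<le> h x + \<epsilon>" by simp
qed

text \<open>The one-sided bound for \<open>l\<close> and for \<open>-l\<close>: a functional along
  which the field is continuous at \<open>x\<close> does not see the regularisation.\<close>

lemma filippov_inner_eq:
  assumes v: "v \<in> filippov g x" and h: "\<And>y. l \<bullet> g y = h y" "(h \<longlongrightarrow> h x) (nhds x)"
  shows "l \<bullet> v = h x"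
proof (rule antisym)
  show "l \<bullet> v \<le> h x" using filippov_inner_le[OF v, of l h] h by simp
  have "- l \<bullet> v \<le> - h x"
    using filippov_inner_le[OF v, of "-l" "\<lambda>y. - h y"] h by (simp add: tendsto_minus)
  then show "h x \<le> l \<bullet> v" by simp
qed

text \<open>Relay and friction act along \<open>B\<close> only, so a functional that annihilates
  \<open>B\<close> sees just the continuous part of the field.\<close>

lemma filippov_relay_inner:
  fixes A :: "real^'n^'n"
  assumes v: "v \<in> filippov (\<lambda>y. A *v y + (- M * sgn (\<eta> \<bullet> y) - f (y $ i)) *\<^sub>R B + a *\<^sub>R D) x"
    and l: "l \<bullet> B = 0"
  shows "l \<bullet> v = l \<bullet> (A *v x + a *\<^sub>R D)"
  by (rule filippov_inner_eq[OF v])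
    (auto simp: inner_add_right l intro!: tendsto_intros
      bounded_linear.tendsto[OF matrix_vector_mul_bounded_linear] filterlim_ident)

text \<open>Off the plane the relay is locally constant and contributes exactly \<open>- M\<close>
  in the direction of the sign. No continuity of \<open>f\<close> is assumed, so friction enters
  through its bound.\<close>

lemma filippov_relay_sgn_inner_le:
  fixes A :: "real^'n^'n"
  assumes v: "v \<in> filippov (\<lambda>y. A *v y + (- M * sgn (\<eta> \<bullet> y) - f (y $ i)) *\<^sub>R B + a *\<^sub>R D) x"
    and B: "\<eta> \<bullet> B = 1" and nz: "\<eta> \<bullet> x \<noteq> 0" and f: "\<And>u. \<bar>f u\<bar> \<le> \<omega>"
  shows "sgn (\<eta> \<bullet> x) * (\<eta> \<bullet> v) \<le> sgn (\<eta> \<bullet> x) * (\<eta> \<bullet> (A *v x + a *\<^sub>R D)) + \<omega> - M"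
proof -
  let ?s = "sgn (\<eta> \<bullet> x)"
  have s: "?s * ?s = 1" "\<bar>?s\<bar> = 1" using nz by (auto simp: sgn_if)
  have "((\<lambda>y. ?s * (\<eta> \<bullet> y)) \<longlongrightarrow> ?s * (\<eta> \<bullet> x)) (nhds x)"
    by (auto intro!: tendsto_intros filterlim_ident)
  moreover have "?s * (\<eta> \<bullet> x) > 0"
    using nz by (simp add: abs_sgn[symmetric] mult.commute[of "sgn _"])
  ultimately have "\<forall>\<^sub>F y in nhds x. ?s * (\<eta> \<bullet> y) > 0"
    by (rule order_tendstoD(1))
  then have ev: "\<forall>\<^sub>F y in nhds x. (?s *\<^sub>R \<eta>) \<bullet> (A *v y + (- M * sgn (\<eta> \<bullet> y) - f (y $ i)) *\<^sub>R B + a *\<^sub>R D)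
      \<le> ?s * (\<eta> \<bullet> (A *v y + a *\<^sub>R D)) + \<omega> - M"
  proof eventually_elim
    case (elim y)
    then have sgn: "sgn (\<eta> \<bullet> y) = ?s" using nz by (auto simp: sgn_if split: if_splits)
    have "?s * (- M * ?s - f (y $ i)) = - M - ?s * f (y $ i)"
      using s(1) by algebra
    moreover have "\<bar>?s * f (y $ i)\<bar> \<le> \<omega>" using f s by (simp add: abs_mult)
    ultimately have "?s * (- M * ?s - f (y $ i)) \<le> \<omega> - M" by linarith
    moreover have "(?s *\<^sub>R \<eta>) \<bullet> (A *v y + (- M * ?s - f (y $ i)) *\<^sub>R B + a *\<^sub>R D)
        = ?s * (\<eta> \<bullet> (A *v y + a *\<^sub>R D)) + ?s * (- M * ?s - f (y $ i))"
      by (simp only: inner_scaleR_left inner_scaleR_right inner_add_right B distrib_left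
          mult_1_right mult_1_left mult_ac add_ac)
    ultimately show ?case unfolding sgn by linarith
  qed
  have "(?s *\<^sub>R \<eta>) \<bullet> v \<le> ?s * (\<eta> \<bullet> (A *v x + a *\<^sub>R D)) + \<omega> - M"
    by (rule filippov_inner_le[OF v ev])
      (auto intro!: tendsto_intros
        bounded_linear.tendsto[OF matrix_vector_mul_bounded_linear] filterlim_ident)
  then show ?thesis by simp
qed

section \<open>Ackermann's formula and the reduced system\<close>

lemma vector_4 [simp]:
  "(vector [x, y, z, w] :: ('a::zero)^4) $ 1 = x"
  "(vector [x, y, z, w] :: ('a::zero)^4) $ 2 = y"
  "(vector [x, y, z, w] :: ('a::zero)^4) $ 3 = z"
  "(vector [x, y, z, w] :: ('a::zero)^4) $ 4 = w"
  unfolding vector_def by simp_all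

lemma matrix_power_0 [simp]: "matrix_power M 0 = mat 1"
  by (simp add: matrix_power_def)

lemma matrix_power_Suc: "matrix_power M (Suc n) = M ** matrix_power M n"
  by (simp add: matrix_power_def)

lemma matrix_power_Suc2: "matrix_power M (Suc n) = matrix_power M n ** M"
  by (induction n) (simp_all add: matrix_power_Suc matrix_mul_assoc)

lemma is_eigenvalue_iff_det:
  fixes M :: "complex^'n^'n"
  shows "is_eigenvalue M s \<longleftrightarrow> det (mat s - M) = 0"
proof -
  have "mat s *v v = s *s v" for v :: "complex^'n"
    by (simp add: vec_eq_iff matrix_vector_mult_def mat_def if_distrib[of "\<lambda>c. c * _"] cong: if_cong)
  then have "(mat s - M) *v v = 0 \<longleftrightarrow> M *v v = s *s v" for v
    by (auto simp: matrix_vector_mult_diff_rdistrib)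
  then have "is_eigenvalue M s \<longleftrightarrow> \<not> (\<forall>v. (mat s - M) *v v = 0 \<longrightarrow> v = 0)"
    unfolding is_eigenvalue_def by blast
  also have "\<dots> \<longleftrightarrow> det (mat s - M) = 0"
    unfolding matrix_left_invertible_ker[symmetric] invertible_left_inverse[symmetric] invertible_det_nz by simp
  finally show ?thesis .
qed

text \<open>The conditions say that \<open>e\<close> times the controllability matrix is the last
  unit row. They also force that matrix to be invertible, because the pairings of \<open>e\<close>
  with the powers of \<open>A\<close> applied to \<open>B\<close> are triangular.\<close>

lemma ackermann_vector_eqI:
  assumes "e \<bullet> B = 0" "e \<bullet> (A *v B) = 0" "e \<bullet> (A *v (A *v B)) = 0" "e \<bullet> (A *v (A *v (A *v B))) = 1"
  shows "ackermann_vector A B = e"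
proof -
  have pow: "matrix_power A 2 *v B = A *v (A *v B)" "matrix_power A 3 *v B = A *v (A *v (A *v B))"
    by (simp_all add: eval_nat_numeral matrix_power_Suc matrix_vector_mul_assoc[symmetric])
  let ?C = "controllability_matrix A B"
  have row: "e v* ?C = vector [0, 0, 0, 1]"
    using assms unfolding controllability_matrix_def vector_transpose_matrix pow
    by (simp add: vec_eq_iff forall_4 matrix_vector_mult_def inner_vec_def sum_4 mult.commute)
  have "y = 0" if "?C *v y = 0" for y
  proof -
    have C: "y $ 1 *\<^sub>R B + y $ 2 *\<^sub>R (A *v B) + y $ 3 *\<^sub>R (A *v (A *v B))
        + y $ 4 *\<^sub>R (A *v (A *v (A *v B))) = 0" (is "?s = 0")
      using that unfolding controllability_matrix_def pow
      by (simp add: vec_eq_iff forall_4 matrix_vector_mult_def transpose_def sum_4 mult.commute)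
    \<comment> \<open>Pairing with \<open>e\<close> isolates the last coefficient. Each further
      application of \<open>A\<close> shifts the next coefficient onto the vector whose pairing with
      \<open>e\<close> is 1; the higher powers carry coefficients already known to be zero.\<close>
    have "e \<bullet> ?s = 0" by (simp add: C)
    then have y4: "y $ 4 = 0" by (simp add: inner_add_right assms)
    have "e \<bullet> (A *v ?s) = 0" by (simp add: C)
    then have y3: "y $ 3 = 0"
      by (simp add: inner_add_right assms y4 matrix_vector_right_distrib matrix_vector_mult_scaleR)
    have "e \<bullet> (A *v (A *v ?s)) = 0" by (simp add: C)
    then have y2: "y $ 2 = 0"
      by (simp add: inner_add_right assms y4 y3 matrix_vector_right_distrib matrix_vector_mult_scaleR)
    have "e \<bullet> (A *v (A *v (A *v ?s))) = 0" by (simp add: C)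
    then have "y $ 1 = 0"
      by (simp add: inner_add_right assms y4 y3 y2 matrix_vector_right_distrib matrix_vector_mult_scaleR)
    with y2 y3 y4 show ?thesis by (simp add: vec_eq_iff forall_4)
  qed
  then have "invertible ?C"
    using invertible_left_inverse matrix_left_invertible_ker by blast
  then have "?C ** matrix_inv ?C = mat 1"
    unfolding matrix_inv_def invertible_def by (metis (mono_tags, lifting) someI_ex)
  then show ?thesis
    unfolding ackermann_vector_def row[symmetric] by (simp add: vector_matrix_mul_assoc)
qed

section \<open>Row vectors times matrix polynomials\<close>

lemma vector_matrix_mult_poly_matrix:
  fixes e :: "real^'n"
  assumes "degree p \<le> n"
  shows "e v* poly_matrix p A = (\<Sum>i\<le>n. coeff p i *\<^sub>R (e v* matrix_power A i))"
proof -
  have "e v* (\<Sum>i\<in>S. g i) = (\<Sum>i\<in>S. e v* g i)" if "finite S" for S :: "nat set" and g :: "nat \<Rightarrow> real^'n^'n"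
    using that by (induction S) (simp_all add: vector_matrix_mult_add_rdistrib)
  then have "e v* poly_matrix p A = (\<Sum>i\<le>degree p. coeff p i *\<^sub>R (e v* matrix_power A i))"
    unfolding poly_matrix_def by (simp add: vector_scaleR_matrix_ac)
  also have "\<dots> = (\<Sum>i\<le>n. coeff p i *\<^sub>R (e v* matrix_power A i))"
    using assms by (intro sum.mono_neutral_left) (auto simp: coeff_eq_0)
  finally show ?thesis .
qed

text \<open>Multiplying a polynomial by its variable shifts the coefficients, which for a row vector
  is one more multiplication by \<open>A\<close> on the right. Applied to \<open>P\<close>, this
  links the gain \<open>k\<close> with \<eta>.\<close>

lemma vector_matrix_mult_poly_matrix_linear_factor:
  fixes e :: "real^'n"
  shows "e v* poly_matrix (p * [:-c, 1:]) A = e v* poly_matrix p A v* A - c *\<^sub>R (e v* poly_matrix p A)"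
proof -
  have sum_v: "(\<Sum>i\<in>S. g i) v* A = (\<Sum>i\<in>S. g i v* A)" if "finite S" for S :: "nat set" and g :: "nat \<Rightarrow> real^'n"
    using that by (induction S) (simp_all add: vector_matrix_left_distrib)
  let ?E = "\<lambda>i. e v* matrix_power A i"
  let ?n = "degree p"
  have deg: "degree (p * [:-c, 1:]) \<le> Suc ?n"
    by (rule order_trans[OF degree_mult_le]) simp
  \<comment> \<open>\<open>pCons 0 p\<close> is \<open>p\<close> times the variable. Both sums run
    up to \<open>Suc ?n\<close>, where the coefficient of \<open>p\<close> is 0.\<close>
  have coeff: "coeff (p * [:-c, 1:]) i = coeff (pCons 0 p) i - c * coeff p i" for i
    by (simp add: algebra_simps)
  have "e v* poly_matrix (p * [:-c, 1:]) A
      = (\<Sum>i\<le>Suc ?n. coeff (pCons 0 p) i *\<^sub>R ?E i) - c *\<^sub>R (\<Sum>i\<le>Suc ?n. coeff p i *\<^sub>R ?E i)"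
    unfolding vector_matrix_mult_poly_matrix[OF deg] coeff
    by (simp only: scaleR_left_diff_distrib sum_subtractf scaleR_sum_right scaleR_scaleR)
  also have "(\<Sum>i\<le>Suc ?n. coeff (pCons 0 p) i *\<^sub>R ?E i) = (\<Sum>i\<le>?n. coeff p i *\<^sub>R (?E i v* A))"
    by (simp add: sum.atMost_Suc_shift matrix_power_Suc2 vector_matrix_mul_assoc del: sum.atMost_Suc)
  also have "\<dots> = e v* poly_matrix p A v* A"
    by (simp add: vector_matrix_mult_poly_matrix[OF order_refl] sum_v scaleR_vector_matrix_assoc)
  also have "(\<Sum>i\<le>Suc ?n. coeff p i *\<^sub>R ?E i) = e v* poly_matrix p A"
    by (rule vector_matrix_mult_poly_matrix[symmetric]) simp
  finally show ?thesis .
qed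

text \<open>The roots may be complex while \<open>p\<close> is real, so Vieta's formulas are
  compared after embedding the real coefficients.\<close>

lemma monic_cubic_coeffs:
  assumes "map_poly complex_of_real p = [:-r1, 1:] * [:-r2, 1:] * [:-r3, 1:]"
  obtains p0 p1 p2 where "p = [:p0, p1, p2, 1:]"
    "\<And>s. s ^ 3 + of_real p2 * s ^ 2 + of_real p1 * s + of_real p0 = (s - r1) * (s - r2) * (s - r3)"
proof -
  have prod: "[:-r1, 1:] * [:-r2, 1:] * [:-r3, 1:] =
      [:- (r1 * r2 * r3), r1 * r2 + r1 * r3 + r2 * r3, - (r1 + r2 + r3), 1:]"
    by (simp add: algebra_simps)
  have coeff: "complex_of_real (coeff p n) = coeff [:- (r1 * r2 * r3), r1 * r2 + r1 * r3 + r2 * r3, - (r1 + r2 + r3), 1:] n" for n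
    using arg_cong[OF assms[unfolded prod], of "\<lambda>q. coeff q n"] by (simp add: coeff_map_poly)
  have "coeff p 3 = 1"
    using coeff[of 3] by (simp add: eval_nat_numeral)
  moreover have "coeff p (Suc (Suc (Suc (Suc n)))) = 0" for n
    using coeff[of "Suc (Suc (Suc (Suc n)))"] by simp
  ultimately have p: "p = [:coeff p 0, coeff p 1, coeff p 2, 1:]"
    by (intro poly_eqI) (simp add: coeff_pCons eval_nat_numeral split: nat.split)
  have "complex_of_real (coeff p 0) = - (r1 * r2 * r3)"
    "complex_of_real (coeff p 1) = r1 * r2 + r1 * r3 + r2 * r3"
    "complex_of_real (coeff p 2) = - (r1 + r2 + r3)"
    using coeff[of 0] coeff[of 1] coeff[of 2] by (simp_all add: eval_nat_numeral)
  note c = this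
  have "s ^ 3 + of_real (coeff p 2) * s ^ 2 + of_real (coeff p 1) * s + of_real (coeff p 0)
      = (s - r1) * (s - r2) * (s - r3)" for s
    unfolding c by (simp add: power3_eq_cube power2_eq_square algebra_simps)
  with p show thesis by (rule that)
qed

text \<open>The shape of the reduced matrix: the second row is the plane equation solved for the
  fourth coordinate, the third row the damper acceleration after this elimination.\<close>

lemma det_third_order:
  fixes q1 q2 q3 r1 r2 r3 :: real
  shows "det (mat s - map_matrix complex_of_real (vector
      [vector [0, 0, 1], vector [- q1, - q2, - q3], vector [r1, r2, r3]] :: real^3^3)) =
    s ^ 3 + of_real (q2 - r3) * s ^ 2 + of_real (q3 * r2 - q2 * r3 - r1) * s
      + of_real (q1 * r2 - q2 * r1)"
  by (simp add: det_3 mat_def map_matrix_def power3_eq_cube power2_eq_square algebra_simps)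

section \<open>Explicit computations for the damper model\<close>

text \<open>The total momentum \<open>L = m\<^sub>0 z\<^sub>4 + m\<^sub>d (z\<^sub>3 + z\<^sub>4)\<close> is not affected by the control force, and
  \<open>L' = - k\<^sub>0 z\<^sub>2 - c\<^sub>0 z\<^sub>4\<close>. The functional \<open>e\<close> is the combination of \<open>L\<close> and the positions whose second
  derivative is \<open>- m\<^sub>0 z\<^sub>2\<close>; its first derivative is \<open>(m\<^sub>0 c\<^sub>0 / k\<^sub>0) z\<^sub>2 + (m\<^sub>0 / k\<^sub>0) L\<close>.\<close>

lemma ackermann_vector_atmd:
  fixes m0 c0 k0 md cd kd :: real
  assumes "m0 > 0" "md > 0" "k0 > 0"
  defines "A \<equiv> atmd_A m0 c0 k0 md cd kd"
    and "e \<equiv> ackermann_vector (atmd_A m0 c0 k0 md cd kd) (atmd_B m0 md)"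
  shows "e = vector [m0 * md / k0, m0 * (m0 + md) / k0 - m0 * c0\<^sup>2 / k0\<^sup>2,
      - (m0 * c0 * md / k0\<^sup>2), - (m0 * c0 * (m0 + md) / k0\<^sup>2)]" (is "_ = ?e")
    and "e v* A = vector [0, m0 * c0 / k0, m0 * md / k0, m0 * (m0 + md) / k0]" (is "_ = ?e1")
    and "e v* A v* A = vector [0, - m0, 0, 0]" (is "_ = ?e2")
    and "e v* A v* A v* A = vector [0, 0, 0, - m0]" (is "_ = ?e3")
    and "e v* A v* A v* A v* A = vector [- kd, k0, - cd, c0]" (is "_ = ?e4")
proof -
  \<comment> \<open>The orbit of the candidate row is computed first. Moving \<open>A\<close> from
    \<open>B\<close> onto the row, the four conditions of Ackermann's formula become pairings of
    these rows with \<open>B\<close>.\<close>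
  have rows: "?e v* A = ?e1" "?e1 v* A = ?e2" "?e2 v* A = ?e3" "?e3 v* A = ?e4"
    using assms(1-3) unfolding A_def atmd_A_def
    by (simp_all add: vec_eq_iff forall_4 vector_matrix_mult_def sum_4 field_simps power2_eq_square)
  show "e = ?e"
    unfolding e_def A_def[symmetric]
    using assms(1-3) by (intro ackermann_vector_eqI; simp only: dot_lmul_matrix[symmetric] rows;
      simp add: atmd_B_def inner_vec_def sum_4 field_simps)
  then show "e v* A = ?e1" "e v* A v* A = ?e2" "e v* A v* A v* A = ?e3" "e v* A v* A v* A v* A = ?e4"
    by (simp_all only: rows)
qed

text \<open>With \<open>r\<close> the third row of \<open>A - B \<eta>\<^sup>T A\<close>, the right-hand sides are the coefficients of the
  characteristic polynomial of \<open>z' = (A - B \<eta>\<^sup>T A) z\<close> restricted to the plane \<open>\<eta> \<bullet> z = 0\<close>, multiplied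
  by \<open>\<eta> $ 4\<close>.\<close>

lemma atmd_sliding_coefficients:
  fixes m0 c0 k0 md cd kd p0 p1 p2 :: real
  assumes pos: "m0 > 0" "md > 0" "k0 > 0"
  defines "A \<equiv> atmd_A m0 c0 k0 md cd kd" and "B \<equiv> atmd_B m0 md"
    and "\<eta> \<equiv> ackermann_vector (atmd_A m0 c0 k0 md cd kd) (atmd_B m0 md) v* poly_matrix [:p0, p1, p2, 1:]
      (atmd_A m0 c0 k0 md cd kd)"
  defines "r \<equiv> (\<lambda>j. A $ 3 $ j - B $ 3 * (\<eta> v* A) $ j)"
  shows "\<eta> \<bullet> B = 1"
    and "p2 * \<eta> $ 4 = \<eta> $ 2 - r 3 * \<eta> $ 4 + r 4 * \<eta> $ 3"
    and "p1 * \<eta> $ 4 = \<eta> $ 3 * r 2 - \<eta> $ 2 * r 3 - r 1 * \<eta> $ 4 + r 4 * \<eta> $ 1"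
    and "p0 * \<eta> $ 4 = \<eta> $ 1 * r 2 - \<eta> $ 2 * r 1"
proof -
  define e where "e = ackermann_vector (atmd_A m0 c0 k0 md cd kd) (atmd_B m0 md)"
  note rows = ackermann_vector_atmd[OF pos, of c0 cd kd, folded e_def, folded A_def]
  have \<eta>: "\<eta> = p0 *\<^sub>R e + p1 *\<^sub>R (e v* A) + p2 *\<^sub>R (e v* A v* A) + e v* A v* A v* A"
    unfolding \<eta>_def A_def[symmetric] B_def[symmetric] e_def
    by (subst vector_matrix_mult_poly_matrix[of _ 3])
      (simp_all add: eval_nat_numeral matrix_power_Suc2 vector_matrix_mul_assoc[symmetric])
  have \<eta>A: "\<eta> v* A = p0 *\<^sub>R (e v* A) + p1 *\<^sub>R (e v* A v* A) + p2 *\<^sub>R (e v* A v* A v* A) + e v* A v* A v* A v* A"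
    unfolding \<eta> by (simp only: vector_matrix_left_distrib scaleR_vector_matrix_assoc)
  \<comment> \<open>The longest products are replaced first, since rewriting \<open>e v* A\<close>
    would destroy them.\<close>
  note \<eta>' = \<eta>[unfolded rows(4), unfolded rows(3), unfolded rows(2), unfolded rows(1)]
    and \<eta>A' = \<eta>A[unfolded rows(5), unfolded rows(4), unfolded rows(3), unfolded rows(2)]
  show "\<eta> \<bullet> B = 1"
    using pos unfolding \<eta>' B_def atmd_B_def
    by (simp add: inner_vec_def sum_4 field_simps)
  have \<eta>_comps: "\<eta> $ 1 = p0 * (m0 * md / k0)"
    "\<eta> $ 2 = p0 * (m0 * (m0 + md) / k0 - m0 * c0\<^sup>2 / k0\<^sup>2) + p1 * (m0 * c0 / k0) - p2 * m0"
    "\<eta> $ 3 = p1 * (m0 * md / k0) - p0 * (m0 * c0 * md / k0\<^sup>2)"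
    "\<eta> $ 4 = p1 * (m0 * (m0 + md) / k0) - p0 * (m0 * c0 * (m0 + md) / k0\<^sup>2) - m0"
    unfolding \<eta>' by simp_all
  \<comment> \<open>The parameters \<open>kd\<close> and \<open>cd\<close> cancel: the passive
    damper force acts along \<open>B\<close>, and the sliding condition eliminates every force along
    \<open>B\<close>.\<close>
  have r_comps: "r 1 = 0"
    "r 2 = k0 / m0 - (m0 + md) / (m0 * md) * (p0 * (m0 * c0 / k0) - p1 * m0 + k0)"
    "r 3 = - ((m0 + md) / (m0 * md) * (p0 * (m0 * md / k0)))"
    "r 4 = c0 / m0 - (m0 + md) / (m0 * md) * (p0 * (m0 * (m0 + md) / k0) - p2 * m0 + c0)"
    unfolding r_def \<eta>A' unfolding A_def B_def atmd_A_def atmd_B_def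
    using pos by (simp_all add: field_simps)
  show "p2 * \<eta> $ 4 = \<eta> $ 2 - r 3 * \<eta> $ 4 + r 4 * \<eta> $ 3"
    using pos unfolding \<eta>_comps r_comps by (simp add: field_simps power2_eq_square)
  show "p1 * \<eta> $ 4 = \<eta> $ 3 * r 2 - \<eta> $ 2 * r 3 - r 1 * \<eta> $ 4 + r 4 * \<eta> $ 1"
    using pos unfolding \<eta>_comps r_comps by (simp add: field_simps power2_eq_square)
  show "p0 * \<eta> $ 4 = \<eta> $ 1 * r 2 - \<eta> $ 2 * r 1"
    using pos unfolding \<eta>_comps r_comps by (simp add: field_simps power2_eq_square)
qed

lemma bounded_linear_vec4_to_vec3: "bounded_linear (\<lambda>x::real^4. vector [x $ 1, x $ 2, x $ 3] :: real^3)"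
  by (intro linear_conv_bounded_linear[THEN iffD1] linearI)
    (simp_all add: vec_eq_iff forall_3)

text \<open>A real \<open>P\<^sub>1\<close> with complex roots encodes eigenvalues closed under
  conjugation, and the determinant identity records their multiplicities. The reduced matrix is
  fixed before friction, ground motion and trajectory. The guard on \<open>\<eta> $ 4\<close> is the
  condition for solving the plane equation for \<open>z\<^sub>4\<close>.\<close>

theorem theorem1:
  fixes m\<^sub>0 c\<^sub>0 k\<^sub>0 m\<^sub>d c\<^sub>d k\<^sub>d \<beta>\<^sub>0 \<mu>\<^sub>4 \<alpha>\<^sub>1 \<alpha>\<^sub>2 :: real
    and \<mu>\<^sub>1 \<mu>\<^sub>2 \<mu>\<^sub>3 :: complex
    and P\<^sub>1 P :: "real poly"
    and A :: "real^4^4"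
    and B D e k \<eta> :: "real^4"
    and B\<^sub>1 :: "real^3"
  assumes "m\<^sub>0 > 0" "m\<^sub>d > 0" "k\<^sub>0 > 0"
    and "A = atmd_A m\<^sub>0 c\<^sub>0 k\<^sub>0 m\<^sub>d c\<^sub>d k\<^sub>d"
    and "B = atmd_B m\<^sub>0 m\<^sub>d"
    and "D = atmd_D \<beta>\<^sub>0"
    and "map_poly complex_of_real P\<^sub>1 = [:-\<mu>\<^sub>1, 1:] * [:-\<mu>\<^sub>2, 1:] * [:-\<mu>\<^sub>3, 1:]"
    and "\<mu>\<^sub>4 < 0"
    and "P = P\<^sub>1 * [:-\<mu>\<^sub>4, 1:]"
    and "e = ackermann_vector A B"
    and "k = e v* poly_matrix P A"
    and "\<eta> = e v* poly_matrix P\<^sub>1 A"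
    and "\<alpha>\<^sub>1 = \<beta>\<^sub>0 * (\<eta> $ 4 - \<eta> $ 3) + \<eta> $ 3"
    and "\<alpha>\<^sub>2 = (\<beta>\<^sub>0 - 1) + \<alpha>\<^sub>1 * (m\<^sub>0 + m\<^sub>d) / (m\<^sub>0 * m\<^sub>d)"
    and "B\<^sub>1 = vector [0, 0, \<alpha>\<^sub>2]"
  shows "\<exists>A\<^sub>1 :: real^3^3.
    {s. is_eigenvalue (map_matrix complex_of_real A\<^sub>1) s} = {\<mu>\<^sub>1, \<mu>\<^sub>2, \<mu>\<^sub>3} \<and>
    (\<forall>s. det (mat s - map_matrix complex_of_real A\<^sub>1) = (s - \<mu>\<^sub>1) * (s - \<mu>\<^sub>2) * (s - \<mu>\<^sub>3)) \<and>
    (\<forall>(f :: real \<Rightarrow> real) (x\<^sub>g :: real \<Rightarrow> real) \<delta> \<omega> h\<^sub>0 M\<^sub>0 (z :: real \<Rightarrow> real^4).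
      (\<forall>t\<ge>0. \<bar>x\<^sub>g t\<bar> \<le> \<delta>) \<longrightarrow>
      (\<forall>v. \<bar>f v\<bar> \<le> \<omega>) \<longrightarrow>
      M\<^sub>0 > 0 \<longrightarrow>
      M\<^sub>0 > \<omega> + h\<^sub>0 \<longrightarrow>
      inclusion_solution
        (\<lambda>t. filippov
          (\<lambda>y. A *v y + (- M\<^sub>0 * sgn (\<eta> \<bullet> y) - f (y $ 3)) *\<^sub>R B + x\<^sub>g t *\<^sub>R D)) 0 z \<longrightarrow>
      (\<forall>t\<ge>0. \<bar>- (k \<bullet> z t) + \<alpha>\<^sub>1 * x\<^sub>g t\<bar> \<le> h\<^sub>0) \<longrightarrow>
      (\<exists>t\<^sub>\<sigma>\<ge>0. t\<^sub>\<sigma> \<le> \<bar>\<eta> \<bullet> z 0\<bar> / (M\<^sub>0 - (\<omega> + h\<^sub>0)) \<and>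
        (\<forall>t. 0 \<le> t \<and> t < t\<^sub>\<sigma> \<longrightarrow> \<eta> \<bullet> z t \<noteq> 0) \<and>
        (\<forall>t\<ge>t\<^sub>\<sigma>. \<eta> \<bullet> z t = 0) \<and>
        (\<eta> $ 4 \<noteq> 0 \<longrightarrow>
          inclusion_solution (\<lambda>t y. {A\<^sub>1 *v y + x\<^sub>g t *\<^sub>R B\<^sub>1}) t\<^sub>\<sigma>
            (\<lambda>t. vector [z t $ 1, z t $ 2, z t $ 3]))))"
proof -
  note defs = assms(4-6,10-15)
  obtain p0 p1 p2 where P1: "P\<^sub>1 = [:p0, p1, p2, 1:]"
    and roots: "\<And>s. s ^ 3 + of_real p2 * s ^ 2 + of_real p1 * s + of_real p0 = (s - \<mu>\<^sub>1) * (s - \<mu>\<^sub>2) * (s - \<mu>\<^sub>3)"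
    using monic_cubic_coeffs[OF assms(7)] by metis
  define r where "r j = A $ 3 $ j - B $ 3 * (\<eta> v* A) $ j" for j
  note coeffs = atmd_sliding_coefficients[OF assms(1-3), where ?c0.0 = c\<^sub>0 and cd = c\<^sub>d and kd = k\<^sub>d and ?p0.0 = p0 and ?p1.0 = p1 and ?p2.0 = p2,
      folded assms(4,5), folded assms(10) P1, folded assms(12), folded r_def]
  have \<eta>A: "\<eta> v* A = k + \<mu>\<^sub>4 *\<^sub>R \<eta>"
    unfolding \<open>k = _\<close> \<open>P = _\<close> \<open>\<eta> = _\<close> vector_matrix_mult_poly_matrix_linear_factor by simp
  have \<eta>D: "\<eta> \<bullet> D = - \<alpha>\<^sub>1"
    unfolding \<open>D = _\<close> \<open>\<alpha>\<^sub>1 = _\<close> by (simp add: atmd_D_def inner_vec_def sum_4 algebra_simps)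
  \<comment> \<open>On the plane \<open>z\<^sub>4\<close> equals minus the sum of \<open>q j\<close>
    times \<open>z\<^sub>j\<close> over the other coordinates; \<open>R\<close> is the row
    \<open>r\<close> after this substitution.\<close>
  define q where "q j = \<eta> $ j / \<eta> $ 4" for j
  define R where "R j = r j - r 4 * q j" for j
  \<comment> \<open>If \<open>\<eta> $ 4 = 0\<close>, then \<open>z\<^sub>4\<close> cannot be eliminated and only the characteristic polynomial matters;
    the first matrix is a companion matrix with its first two coordinates swapped.\<close>
  define A1 :: "real^3^3" where "A1 = (if \<eta> $ 4 = 0
    then vector [vector [0, 0, 1], vector [- (-1), - 0, - 0], vector [- p1, - p0, - p2]]
    else vector [vector [0, 0, 1], vector [- q 1, - q 2, - q 3], vector [R 1, R 2, R 3]])"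
  have char: "det (mat s - map_matrix complex_of_real A1) = (s - \<mu>\<^sub>1) * (s - \<mu>\<^sub>2) * (s - \<mu>\<^sub>3)" for s
  proof (cases "\<eta> $ 4 = 0")
    case True
    \<comment> \<open>The entries \<open>- (-1)\<close> and \<open>- 0\<close> were written so that
      the general determinant formula matches literally.\<close>
    then show ?thesis
      unfolding A1_def roots[symmetric] by (simp only: True simp_thms if_True det_third_order) simp
  next
    case False
    then have "p2 = q 2 - R 3" "p1 = q 3 * R 2 - q 2 * R 3 - R 1" "p0 = q 1 * R 2 - q 2 * R 1"
      using coeffs(2-4)[unfolded nonzero_eq_divide_eq[OF False, symmetric]]
      by (simp_all add: q_def R_def add_divide_distrib diff_divide_distrib algebra_simps)
    then show ?thesis
      using False unfolding A1_def roots[symmetric] by (simp only: if_False det_third_order)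
  qed
  have dyn: "\<exists>t\<^sub>\<sigma>\<ge>0. t\<^sub>\<sigma> \<le> \<bar>\<eta> \<bullet> z 0\<bar> / (M\<^sub>0 - (\<omega> + h\<^sub>0)) \<and>
        (\<forall>t. 0 \<le> t \<and> t < t\<^sub>\<sigma> \<longrightarrow> \<eta> \<bullet> z t \<noteq> 0) \<and>
        (\<forall>t\<ge>t\<^sub>\<sigma>. \<eta> \<bullet> z t = 0) \<and>
        (\<eta> $ 4 \<noteq> 0 \<longrightarrow>
          inclusion_solution (\<lambda>t y. {A1 *v y + x\<^sub>g t *\<^sub>R B\<^sub>1}) t\<^sub>\<sigma>
            (\<lambda>t. vector [z t $ 1, z t $ 2, z t $ 3]))"
    if f: "\<forall>v. \<bar>f v\<bar> \<le> \<omega>" and M: "M\<^sub>0 > \<omega> + h\<^sub>0"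
      and sol: "inclusion_solution (\<lambda>t. filippov
          (\<lambda>y. A *v y + (- M\<^sub>0 * sgn (\<eta> \<bullet> y) - f (y $ 3)) *\<^sub>R B + x\<^sub>g t *\<^sub>R D)) 0 z"
      and h: "\<forall>t\<ge>0. \<bar>- (k \<bullet> z t) + \<alpha>\<^sub>1 * x\<^sub>g t\<bar> \<le> h\<^sub>0"
    for f x\<^sub>g :: "real \<Rightarrow> real" and \<omega> h\<^sub>0 M\<^sub>0 and z :: "real \<Rightarrow> real^4"
  proof -
    let ?F = "\<lambda>t. filippov (\<lambda>y. A *v y + (- M\<^sub>0 * sgn (\<eta> \<bullet> y) - f (y $ 3)) *\<^sub>R B + x\<^sub>g t *\<^sub>R D)"
    define c where "c = M\<^sub>0 - (\<omega> + h\<^sub>0)"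
    have "c > 0" using M by (simp add: c_def)
    have ac: "absolutely_continuous_on {0..T} z" for T
      using sol by (simp add: inclusion_solution_def)
    have AE: "AE t in lebesgue. 0 < t \<longrightarrow> (\<exists>v\<in>?F t (z t). (z has_vector_derivative v) (at t))"
      using sol by (simp add: inclusion_solution_def)
    have \<sigma>': "((\<lambda>t. \<eta> \<bullet> z t) has_real_derivative \<eta> \<bullet> v) (at t)"
      if "(z has_vector_derivative v) (at t)" for t v
      unfolding has_real_derivative_iff_has_vector_derivative
      by (rule bounded_linear.has_vector_derivative[OF bounded_linear_inner_right that])
    \<comment> \<open>The relation between \<open>k\<close> and \<eta> turns the uncontrolled drift
      of \<sigma> into a multiple of \<sigma> minus exactly the quantity bounded by
      \<open>h\<^sub>0\<close>.\<close>
    have drift: "\<eta> \<bullet> (A *v z t + x\<^sub>g t *\<^sub>R D) = \<mu>\<^sub>4 * (\<eta> \<bullet> z t) - (- (k \<bullet> z t) + \<alpha>\<^sub>1 * x\<^sub>g t)" for t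
      by (simp add: inner_add_right inner_add_left dot_lmul_matrix[symmetric] \<eta>A \<eta>D)
    have "absolutely_continuous_on {0..T} (\<lambda>t. \<bar>\<eta> \<bullet> z t\<bar>)" for T
      by (rule absolutely_continuous_on_lipschitz_image[of _ "\<lambda>t. \<eta> \<bullet> z t" abs 1])
        (auto intro: absolutely_continuous_on_bounded_linear[OF ac bounded_linear_inner_right])
    moreover have "AE t in lebesgue. 0 < t \<longrightarrow> \<bar>\<eta> \<bullet> z t\<bar> \<noteq> 0 \<longrightarrow>
        (\<exists>d\<le>-c. ((\<lambda>t. \<bar>\<eta> \<bullet> z t\<bar>) has_real_derivative d) (at t))"
      using AE
    proof eventually_elim
      case (elim t)
      show ?case
      proof (intro impI)
        assume "0 < t" "\<bar>\<eta> \<bullet> z t\<bar> \<noteq> 0"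
        with elim obtain v where v: "v \<in> ?F t (z t)" "(z has_vector_derivative v) (at t)"
          and nz: "\<eta> \<bullet> z t \<noteq> 0" by auto
        let ?s = "sgn (\<eta> \<bullet> z t)"
        have "?s * (\<eta> \<bullet> v) \<le> ?s * (\<eta> \<bullet> (A *v z t + x\<^sub>g t *\<^sub>R D)) + \<omega> - M\<^sub>0"
          using filippov_relay_sgn_inner_le[OF v(1) coeffs(1) nz] f by blast
        also have "?s * (\<eta> \<bullet> (A *v z t + x\<^sub>g t *\<^sub>R D))
            = \<mu>\<^sub>4 * \<bar>\<eta> \<bullet> z t\<bar> - ?s * (- (k \<bullet> z t) + \<alpha>\<^sub>1 * x\<^sub>g t)"
          unfolding drift abs_sgn by (simp add: algebra_simps)
        \<comment> \<open>Negativity of \<open>\<mu>\<^sub>4\<close> makes the first term help the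
          decrease; the second is bounded by \<open>h\<^sub>0\<close>.\<close>
        also have "\<dots> \<le> 0 + h\<^sub>0"
        proof -
          have "\<bar>?s * (- (k \<bullet> z t) + \<alpha>\<^sub>1 * x\<^sub>g t)\<bar> \<le> h\<^sub>0"
            using h \<open>0 < t\<close> nz unfolding abs_mult by (simp add: abs_sgn_eq)
          moreover have "\<mu>\<^sub>4 * \<bar>\<eta> \<bullet> z t\<bar> \<le> 0"
            using \<open>\<mu>\<^sub>4 < 0\<close> by (simp add: mult_nonpos_nonneg)
          ultimately show ?thesis by linarith
        qed
        finally have "?s * (\<eta> \<bullet> v) \<le> - c" by (simp add: c_def)
        with has_real_derivative_abs[OF \<sigma>'[OF v(2)] nz]
        show "\<exists>d\<le>-c. ((\<lambda>t. \<bar>\<eta> \<bullet> z t\<bar>) has_real_derivative d) (at t)" by blast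
      qed
    qed
    ultimately obtain t0 where t0: "0 \<le> t0" "t0 \<le> \<bar>\<eta> \<bullet> z 0\<bar> / c"
      "\<And>t. 0 \<le> t \<Longrightarrow> t < t0 \<Longrightarrow> \<eta> \<bullet> z t \<noteq> 0" "\<And>t. t0 \<le> t \<Longrightarrow> \<eta> \<bullet> z t = 0"
      using nonneg_decrease_reaches_zero[of "\<lambda>t. \<bar>\<eta> \<bullet> z t\<bar>" c] \<open>c > 0\<close> by auto
    have "inclusion_solution (\<lambda>t y. {A1 *v y + x\<^sub>g t *\<^sub>R B\<^sub>1}) t0
        (\<lambda>t. vector [z t $ 1, z t $ 2, z t $ 3])" if \<eta>4: "\<eta> $ 4 \<noteq> 0"
      unfolding inclusion_solution_def
    proof (intro conjI allI)
      show "absolutely_continuous_on {t0..T} (\<lambda>t. vector [z t $ 1, z t $ 2, z t $ 3] :: real^3)" for T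
        by (intro absolutely_continuous_on_bounded_linear[OF _ bounded_linear_vec4_to_vec3]
          absolutely_continuous_on_subset[OF ac[of T]]) (use \<open>0 \<le> t0\<close> in auto)
      show "AE t in lebesgue. t0 < t \<longrightarrow> (\<exists>v\<in>{A1 *v vector [z t $ 1, z t $ 2, z t $ 3] + x\<^sub>g t *\<^sub>R B\<^sub>1}.
          ((\<lambda>t. vector [z t $ 1, z t $ 2, z t $ 3]) has_vector_derivative v) (at t))"
        using AE
      proof eventually_elim
        case (elim t)
        show ?case
        proof
          assume "t0 < t"
          with elim \<open>0 \<le> t0\<close> obtain v where v: "v \<in> ?F t (z t)" "(z has_vector_derivative v) (at t)"
            by auto
          \<comment> \<open>Strictly after \<open>t0\<close> there is a whole neighbourhood on which
            \<sigma> vanishes.\<close>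
          have "((\<lambda>t. \<eta> \<bullet> z t) has_real_derivative 0) (at t)"
            by (rule has_field_derivative_transform_within_open[of "\<lambda>_. 0" _ _ "{t0<..}"])
              (use \<open>t0 < t\<close> t0(4) in auto)
          then have \<eta>v: "\<eta> \<bullet> v = 0" by (rule DERIV_unique[OF \<sigma>'[OF v(2)]])
          \<comment> \<open>Since \<open>\<eta> \<bullet> B = 1\<close>, the functional
            \<open>axis i 1 - B $ i *\<^sub>R \<eta>\<close> annihilates \<open>B\<close>, so it
            takes a determined value on \<open>v\<close>. With \<open>\<eta> \<bullet> v = 0\<close>
            this value is the component itself: the equivalent control without naming it.\<close>
          have comp: "v $ i = (A *v z t) $ i + x\<^sub>g t * D $ i - B $ i * ((\<eta> v* A) \<bullet> z t - x\<^sub>g t * \<alpha>\<^sub>1)" for i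
          proof -
            have "(axis i 1 - B $ i *\<^sub>R \<eta>) \<bullet> v = (axis i 1 - B $ i *\<^sub>R \<eta>) \<bullet> (A *v z t + x\<^sub>g t *\<^sub>R D)"
              by (rule filippov_relay_inner[OF v(1)])
                (simp add: inner_diff_left coeffs(1) inner_axis')
            then show ?thesis
              by (simp add: inner_diff_left inner_axis' \<eta>v inner_add_right \<eta>D dot_lmul_matrix algebra_simps)
          qed
          have z4: "z t $ 4 = - q 1 * z t $ 1 - q 2 * z t $ 2 - q 3 * z t $ 3"
          proof -
            have "z t $ 4 * \<eta> $ 4 = - (\<eta> $ 1 * z t $ 1) - \<eta> $ 2 * z t $ 2 - \<eta> $ 3 * z t $ 3"
              using t0(4)[of t] \<open>t0 < t\<close> by (simp add: inner_vec_def sum_4 algebra_simps)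
            then show ?thesis
              unfolding nonzero_eq_divide_eq[OF \<eta>4, symmetric] by (simp add: q_def diff_divide_distrib)
          qed
          have v12: "v $ 1 = z t $ 3" "v $ 2 = z t $ 4"
            unfolding comp
            by (simp_all add: \<open>A = _\<close> \<open>B = _\<close> \<open>D = _\<close> atmd_A_def atmd_B_def atmd_D_def
                matrix_vector_mult_def sum_4)
          have B3: "B $ 3 = (m\<^sub>0 + m\<^sub>d) / (m\<^sub>0 * m\<^sub>d)" "D $ 3 = \<beta>\<^sub>0 - 1"
            by (simp_all add: \<open>B = _\<close> \<open>D = _\<close> atmd_B_def atmd_D_def)
          \<comment> \<open>The ground acceleration enters directly through \<open>D $ 3\<close> and
            through \<open>B $ 3 * \<alpha>\<^sub>1\<close>; together these are
            \<open>\<alpha>\<^sub>2\<close>.\<close>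
          have "v $ 3 = r 1 * z t $ 1 + r 2 * z t $ 2 + r 3 * z t $ 3 + r 4 * z t $ 4 + x\<^sub>g t * \<alpha>\<^sub>2"
            unfolding comp r_def \<open>\<alpha>\<^sub>2 = _\<close>
            by (simp add: matrix_vector_mult_def inner_vec_def sum_4 B3 algebra_simps)
          also have "\<dots> = R 1 * z t $ 1 + R 2 * z t $ 2 + R 3 * z t $ 3 + x\<^sub>g t * \<alpha>\<^sub>2"
            unfolding z4 R_def by (simp add: algebra_simps)
          finally have v3: "v $ 3 = \<dots>" .
          have "A1 *v vector [z t $ 1, z t $ 2, z t $ 3] + x\<^sub>g t *\<^sub>R B\<^sub>1 = vector [v $ 1, v $ 2, v $ 3]"
            using \<eta>4 unfolding v12 v3 z4
            by (simp add: A1_def \<open>B\<^sub>1 = _\<close> vec_eq_iff forall_3 matrix_vector_mult_def sum_3)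
          then show "\<exists>v\<in>{A1 *v vector [z t $ 1, z t $ 2, z t $ 3] + x\<^sub>g t *\<^sub>R B\<^sub>1}.
              ((\<lambda>t. vector [z t $ 1, z t $ 2, z t $ 3]) has_vector_derivative v) (at t)"
            using bounded_linear.has_vector_derivative[OF bounded_linear_vec4_to_vec3 v(2)] by simp
        qed
      qed
    qed
    with t0 show ?thesis unfolding c_def by blast
  qed
  show ?thesis
  proof (intro exI[of _ A1] conjI allI impI)
    show "{s. is_eigenvalue (map_matrix complex_of_real A1) s} = {\<mu>\<^sub>1, \<mu>\<^sub>2, \<mu>\<^sub>3}"
      by (auto simp: is_eigenvalue_iff_det char)
  qed (use char dyn in auto)
qed

end
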